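(* Let $J(x)=\tfrac12(x+x^{-1})-1$ for $x>0$. Let $S,\mathcal{M},O$ be sets with scale maps $\iota_S:S\to\mathbb{R}_{>0}$, $\iota_M:\mathcal{M}\to\mathbb{R}_{>0}$, $\iota_O:O\to\mathbb{R}_{>0}$, and let $\mathcal{R}_1$ (from $S$ to $\mathcal{M}$) and $\mathcal{R}_2$ (from $\mathcal{M}$ to $O$) be the admissible reference structures with costs $c_{\mathcal{R}_1}(s,m)=J(\iota_S(s)/\iota_M(m))$ and $c_{\mathcal{R}_2}(m,o)=J(\iota_M(m)/\iota_O(o))$. Fix $s\in S$ and $o\in O$ and set $a:=\iota_S(s)$, $c:=\iota_O(o)$. Assume $Y_M:=\iota_M(\mathcal{M})\subset\mathbb{R}_{>0}$ is nonempty and closed in the usual topology on $(0,\infty)$. Set $b_{\mathrm{geo}}:=\sqrt{ac}$ and $U:=\{\log b:\ b\in Y_M\}\subset\mathbb{R}$. Then the infimum $$c_{\mathcal{R}_2\circ\mathcal{R}_1}(s,o)=\inf_{m\in\mathcal{M}}\big[c_{\mathcal{R}_1}(s,m)+c_{\mathcal{R}_2}(m,o)\big]$$ is attained by at least one $m_*\in\mathcal{M}$. Moreover, a mediator $m\in\mathcal{M}$ with $b:=\iota_M(m)$ is optimal (attains this infimum) if and only if $u=\log b$ minimizes $|u-\log b_{\mathrm{geo}}|$ over $u\in U$ (equivalently, $b$ minimizes $|\log(b/b_{\mathrm{geo}})|$ over $Y_M$). In particular, if $b_{\mathrm{geo}}\in Y_M$, then the optimal mediator ratio (the value $\iota_M(m)$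 at an optimal $m$) is unique and equals $b_{\mathrm{geo}}$, and in that case, choosing $m_*\in\mathcal{M}$ with $\iota_M(m_* )=b_{\mathrm{geo}}$ gives $$c_{\mathcal{R}_2\circ\mathcal{R}_1}(s,o)=J\!\left(\frac{a}{b_{\mathrm{geo}}}\right)+J\!\left(\frac{b_{\mathrm{geo}}}{c}\right)=2\,J\!\left(\sqrt{\frac{a}{c}}\right).$$
   Context: A reference structure from a set $A$ to a set $B$ is a cost function $A\times B\to\mathbb{R}_{\ge0}$; it is admissible if it has the ratio form $J(\iota_A(\cdot)/\iota_B(\cdot))$. The sequential composition $\mathcal{R}_2\circ\mathcal{R}_1$ is the reference structure from $S$ to $O$ whose cost is the infimum displayed in the claim. *)

theory Defs
  imports "HOL-Analysis.Analysis"
begin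

text \<open>Only the values at positive arguments are meaningful.\<close>

definition J :: "real \<Rightarrow> real" where
  "J x = (x + inverse x) / 2 - 1"

definition reference_structure :: "'a set \<Rightarrow> 'b set \<Rightarrow> ('a \<Rightarrow> 'b \<Rightarrow> real) \<Rightarrow> bool" where
  "reference_structure A B cost \<longleftrightarrow> (\<forall>x\<in>A. \<forall>y\<in>B. 0 \<le> cost x y)"

text \<open>Admissibility is relative to the scale maps of source and target.\<close>

definition admissible ::
  "'a set \<Rightarrow> 'b set \<Rightarrow> ('a \<Rightarrow> real) \<Rightarrow> ('b \<Rightarrow> real) \<Rightarrow> ('a \<Rightarrow> 'b \<Rightarrow> real) \<Rightarrow> bool" where
  "admissible A B \<iota>A \<iota>B cost \<longleftrightarrow>
     reference_structure A B cost \<and> (\<forall>x\<in>A. \<forall>y\<in>B. cost x y = J (\<iota>A x / \<iota>B y))"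

text \<open>The infimum is taken in the reals: it is the genuine infimum as soon as \<open>M\<close> is
  nonempty, since costs of reference structures are bounded below by 0.\<close>

definition seq_comp ::
  "'m set \<Rightarrow> ('a \<Rightarrow> 'm \<Rightarrow> real) \<Rightarrow> ('m \<Rightarrow> 'b \<Rightarrow> real) \<Rightarrow> 'a \<Rightarrow> 'b \<Rightarrow> real" where
  "seq_comp M cost1 cost2 x y = (INF m\<in>M. cost1 x m + cost2 m y)"

definition optimal_mediator ::
  "'m set \<Rightarrow> ('a \<Rightarrow> 'm \<Rightarrow> real) \<Rightarrow> ('m \<Rightarrow> 'b \<Rightarrow> real) \<Rightarrow> 'a \<Rightarrow> 'b \<Rightarrow> 'm \<Rightarrow> bool" where
  "optimal_mediator M cost1 cost2 x y m \<longleftrightarrow>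
     m \<in> M \<and> cost1 x m + cost2 m y = seq_comp M cost1 cost2 x y"

lemma J_nonneg: "0 \<le> J x" if "0 < x"
proof -
  have "J x = (x - 1)\<^sup>2 / (2 * x)"
    using that by (simp add: J_def power2_eq_square field_simps)
  then show ?thesis using that by simp
qed

lemma admissible_ratio_cost:
  assumes "\<iota>A \<in> A \<rightarrow> {0<..}" and "\<iota>B \<in> B \<rightarrow> {0<..}"
  shows "admissible A B \<iota>A \<iota>B (\<lambda>x y. J (\<iota>A x / \<iota>B y))"
  using assms by (auto simp: admissible_def reference_structure_def Pi_iff intro!: J_nonneg)

lemma reference_structure_seq_comp:
  assumes "M \<noteq> {}" "reference_structure A M cost1" "reference_structure M B cost2"
  shows "reference_structure A B (seq_comp M cost1 cost2)"
  using assms unfolding reference_structure_def seq_comp_def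
  by (auto intro!: cINF_greatest)

end

theory Submission
  imports Defs
begin

text \<open>In logarithmic coordinates \<open>J\<close> is \<open>cosh - 1\<close>, so the addition formula for \<open>cosh\<close> turns the
  total cost through a mediator of scale \<open>b\<close> into \<open>2 cosh (ln (a / c) / 2) cosh (ln (b / b_geo)) - 2\<close>.
  This is strictly increasing in \<open>\<bar>ln (b / b_geo)\<bar>\<close>, so optimal mediators are the nearest points of
  the closed set \<open>U\<close> to \<open>ln b_geo\<close>.\<close>

lemma J_exp: "J (exp x) = cosh x - 1"
  by (simp add: J_def cosh_def exp_minus)

lemma J_eq_cosh_ln: "J x = cosh (ln x) - 1" if "0 < x"
  using J_exp[of "ln x"] that by simp

lemma J_div_add_J_div:
  assumes "0 < a" "0 < b" "0 < c"
  shows "J (a / b) + J (b / c) = 2 * cosh (ln (a / c) / 2) * cosh (ln (b / sqrt (a * c))) - 2"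
proof -
  let ?r = "ln (a / c) / 2" and ?t = "ln (b / sqrt (a * c))"
  \<comment> \<open>The number \<open>ln (sqrt (a * c))\<close> is the midpoint of
    \<open>ln a\<close> and \<open>ln c\<close>, so the two log ratios lie symmetrically about
    \<open>?r\<close>, at offset \<open>?t\<close>.\<close>
  have "ln (a / b) = ?r - ?t" "ln (b / c) = ?r + ?t"
    using assms by (simp_all add: ln_div ln_mult ln_sqrt field_simps)
  then have "J (a / b) + J (b / c) = cosh (?r - ?t) + cosh (?r + ?t) - 2"
    using assms by (simp add: J_eq_cosh_ln)
  then show ?thesis
    by (simp add: cosh_add cosh_diff)
qed

text \<open>The factor \<open>2 * cosh (ln (a / c) / 2)\<close> is positive and the same for both
  mediators, so it cancels. Since \<open>cosh\<close> is even and strictly increasing on the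
  nonnegative reals, what is left compares absolute values.\<close>

lemma J_div_add_J_div_le_iff:
  assumes "0 < a" "0 < b" "0 < b'" "0 < c"
  shows "J (a / b) + J (b / c) \<le> J (a / b') + J (b' / c) \<longleftrightarrow>
    \<bar>ln (b / sqrt (a * c))\<bar> \<le> \<bar>ln (b' / sqrt (a * c))\<bar>"
  using assms cosh_real_nonneg_le_iff[of "\<bar>ln (b / sqrt (a * c))\<bar>" "\<bar>ln (b' / sqrt (a * c))\<bar>"]
  by (simp add: J_div_add_J_div cosh_real_pos)

text \<open>Costs are nonnegative, so 0 bounds the sums below and the real \<open>INF\<close> lies
  below each of them. An attained infimum is then the same as a minimum.\<close>

lemma optimal_mediator_iff:
  assumes "reference_structure A M cost1" "reference_structure M B cost2" "x \<in> A" "y \<in> B"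
  shows "optimal_mediator M cost1 cost2 x y m \<longleftrightarrow>
    m \<in> M \<and> (\<forall>m'\<in>M. cost1 x m + cost2 m y \<le> cost1 x m' + cost2 m' y)"
proof -
  have "bdd_below ((\<lambda>m. cost1 x m + cost2 m y) ` M)"
    using assms by (auto simp: reference_structure_def intro!: bdd_belowI[where m = 0])
  then show ?thesis
    unfolding optimal_mediator_def seq_comp_def
    by (auto intro: cINF_lower cInf_eq_minimum[symmetric])
qed

text \<open>The logarithm is a homeomorphism from the positive reals onto the whole line, sending 0
  off to minus infinity. Relative closedness thus becomes closedness: the image is the preimage of a
  closed set under the continuous map \<open>exp\<close>.\<close>

lemma closed_ln_image:
  assumes "closedin (top_of_set {0<..}) Y"
  shows "closed (ln ` Y :: real set)"
proof -
  obtain T where T: "closed T" "Y = {0<..} \<inter> T"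
    using assms by (auto simp: closedin_closed)
  have "ln ` Y = exp -` T"
  proof
    show "exp -` T \<subseteq> ln ` Y"
      using T(2) by (auto intro!: image_eqI[where x = "exp _"])
  qed (use T(2) in auto)
  then show ?thesis
    using T(1) by (simp add: closed_vimage continuous_on_exp)
qed

theorem theorem5p5:
  fixes S :: "'s set" and M :: "'m set" and Obj :: "'o set"
    and \<iota>S :: "'s \<Rightarrow> real" and \<iota>M :: "'m \<Rightarrow> real" and \<iota>O :: "'o \<Rightarrow> real"
    and cost1 :: "'s \<Rightarrow> 'm \<Rightarrow> real" and cost2 :: "'m \<Rightarrow> 'o \<Rightarrow> real"
    and s :: 's and obj :: 'o
    and a c b_geo :: real and Y_M U :: "real set"
  assumes "\<iota>S \<in> S \<rightarrow> {0<..}" and "\<iota>M \<in> M \<rightarrow> {0<..}" and "\<iota>O \<in> Obj \<rightarrow> {0<..}"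
    and "admissible S M \<iota>S \<iota>M cost1" and "admissible M Obj \<iota>M \<iota>O cost2"
    and "s \<in> S" and "obj \<in> Obj"
    and "a = \<iota>S s" and "c = \<iota>O obj"
    and "Y_M = \<iota>M ` M"
    and "Y_M \<noteq> {}" and "closedin (top_of_set {0<..}) Y_M"
    and "b_geo = sqrt (a * c)"
    and "U = ln ` Y_M"
  shows "(\<exists>m\<in>M. optimal_mediator M cost1 cost2 s obj m) \<and>
    (\<forall>m\<in>M.
       (optimal_mediator M cost1 cost2 s obj m \<longleftrightarrow>
          is_arg_min (\<lambda>u. \<bar>u - ln b_geo\<bar>) (\<lambda>u. u \<in> U) (ln (\<iota>M m))) \<and>
       (optimal_mediator M cost1 cost2 s obj m \<longleftrightarrow>
          is_arg_min (\<lambda>b. \<bar>ln (b / b_geo)\<bar>) (\<lambda>b. b \<in> Y_M) (\<iota>M m))) \<and>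
    (b_geo \<in> Y_M \<longrightarrow>
       \<iota>M ` {m. optimal_mediator M cost1 cost2 s obj m} = {b_geo} \<and>
       (\<forall>m\<in>M. \<iota>M m = b_geo \<longrightarrow>
          optimal_mediator M cost1 cost2 s obj m \<and>
          seq_comp M cost1 cost2 s obj = J (a / b_geo) + J (b_geo / c) \<and>
          J (a / b_geo) + J (b_geo / c) = 2 * J (sqrt (a / c))))"
proof -
  let ?cost = "\<lambda>m. cost1 s m + cost2 m obj"
  let ?opt = "optimal_mediator M cost1 cost2 s obj"
  let ?dist = "\<lambda>m. \<bar>ln (\<iota>M m / b_geo)\<bar>"
  have pos: "0 < a" "0 < c" "0 < b_geo" and posM: "\<And>m. m \<in> M \<Longrightarrow> 0 < \<iota>M m"
    using assms by (auto simp: Pi_iff)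
  have cost: "?cost m = J (a / \<iota>M m) + J (\<iota>M m / c)" if "m \<in> M" for m
    using assms that by (auto simp: admissible_def)
  \<comment> \<open>From here on optimality is a statement about \<open>?dist\<close> alone.\<close>
  have opt: "?opt m \<longleftrightarrow> m \<in> M \<and> (\<forall>m'\<in>M. ?dist m \<le> ?dist m')" for m
  proof -
    have "reference_structure S M cost1" "reference_structure M Obj cost2"
      using assms(4,5) by (auto simp: admissible_def)
    from optimal_mediator_iff[OF this \<open>s \<in> S\<close> \<open>obj \<in> Obj\<close>] show ?thesis
      using J_div_add_J_div_le_iff[OF pos(1) posM posM pos(2)] \<open>b_geo = _\<close> by (auto simp: cost)
  qed
  have ln_dist: "\<bar>ln (\<iota>M m) - ln b_geo\<bar> = ?dist m" if "m \<in> M" for m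
    using posM[OF that] pos by (simp add: ln_div)
  have "closed U" "U \<noteq> {}"
    using assms closed_ln_image by auto
  \<comment> \<open>A nonempty closed subset of the line, bounded or not, has a point nearest to
    \<open>ln b_geo\<close>. Any mediator whose log scale is that point is optimal.\<close>
  then obtain u where "u \<in> U" "\<forall>v\<in>U. dist (ln b_geo) u \<le> dist (ln b_geo) v"
    using distance_attains_inf by metis
  then obtain m0 where "m0 \<in> M" "?opt m0"
    by (auto simp: \<open>U = _\<close> \<open>Y_M = _\<close> opt dist_real_def abs_minus_commute[of "ln b_geo"] ln_dist)
  \<comment> \<open>Both minimization problems unfold to minimality of \<open>?dist\<close> over
    \<open>M\<close>.\<close>
  have arg_min_U: "?opt m \<longleftrightarrow> is_arg_min (\<lambda>u. \<bar>u - ln b_geo\<bar>) (\<lambda>u. u \<in> U) (ln (\<iota>M m))"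
    and arg_min_Y: "?opt m \<longleftrightarrow> is_arg_min (\<lambda>b. \<bar>ln (b / b_geo)\<bar>) (\<lambda>b. b \<in> Y_M) (\<iota>M m)"
    if "m \<in> M" for m
    using that by (auto simp: opt is_arg_min_linorder \<open>U = _\<close> \<open>Y_M = _\<close> ln_dist simp flip: Ball_def)
  have opt_geo: "?opt m \<longleftrightarrow> m \<in> M \<and> \<iota>M m = b_geo" if geo: "b_geo \<in> Y_M" for m
  proof -
    obtain m1 where m1: "m1 \<in> M" "\<iota>M m1 = b_geo"
      using geo \<open>Y_M = _\<close> by auto
    \<comment> \<open>The least distance is now 0, and the injectivity of \<open>ln\<close> on
      positive reals leaves \<open>b_geo\<close> as the only optimal scale.\<close>
    have "?dist m1 = 0"
      using m1 pos by simp
    moreover have "?dist m = 0 \<longleftrightarrow> \<iota>M m = b_geo" if "m \<in> M"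
      using posM[OF that] pos by auto
    ultimately show ?thesis
      using m1(1) unfolding opt by fastforce
  qed
  \<comment> \<open>The geometric mean splits the ratio \<open>a / c\<close> into two equal factors,
    so both legs cost the same.\<close>
  have "a / b_geo = sqrt (a / c)" "b_geo / c = sqrt (a / c)"
    using pos by (simp_all add: \<open>b_geo = _\<close> real_sqrt_mult real_sqrt_divide field_simps)
  then have J_geo: "J (a / b_geo) + J (b_geo / c) = 2 * J (sqrt (a / c))"
    by simp
  have "\<iota>M ` {m. ?opt m} = {b_geo}" if "b_geo \<in> Y_M"
    using that \<open>Y_M = _\<close> by (auto simp: opt_geo)
  moreover have "?opt m \<and> seq_comp M cost1 cost2 s obj = J (a / b_geo) + J (b_geo / c)"
    if "m \<in> M" "\<iota>M m = b_geo" for m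
  proof -
    have "?opt m"
      using that opt_geo \<open>Y_M = _\<close> by blast
    then show ?thesis
      using that cost[of m] by (simp add: optimal_mediator_def)
  qed
  ultimately show ?thesis
    using \<open>m0 \<in> M\<close> \<open>?opt m0\<close> arg_min_U arg_min_Y J_geo by blast
qed

end
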